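(* Under the standing assumptions in the context, let the sequence $(x_k)_{k\ge0}$ be generated by PSGA (with $\beta\in(0,1)$ and $x_0\in\mathcal{T}_\beta$) with the constant step-size $\alpha_k=\alpha$ satisfying $$0<\alpha\le\frac{2(1-\beta)\tau}{\sqrt{1+4(1-\beta)^2\tau^2}}\Big(\frac{\beta\mu}{\rho G_h}\Big)^{1/\nu}.$$ Then $$\operatorname{dist}^2(x_k;\mathcal{X}^* )-D_*^2\le\max\Big\{\big(\operatorname{dist}^2(x_0;\mathcal{X}^* )-D_*^2\big)q^k,\ \alpha^2\Big\},\qquad\forall k\ge0,$$ where $D_*:=\frac{\alpha}{2(1-\beta)\tau}$ and $q:=1-(1-\beta)\alpha\tau\Big(\frac{\rho G_h}{\beta\mu}\Big)^{1/\nu}>0$.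
   Context: Notation: $\|\cdot\|$ is the Euclidean norm on $\mathbb{R}^n$, $\operatorname{dist}(x;S)=\inf_{z\in S}\|z-x\|$, $\operatorname{proj}_S(x)=\operatorname{argmin}_{z\in S}\|z-x\|$ (a set in general). $\partial f(x)$ is the Fréchet subdifferential: all $\zeta$ with $f(y)\ge f(x)+\langle\zeta,y-x\rangle+o(\|y-x\|)$ as $y\to x$. Standing assumptions, for the problem of minimizing $f$ over $X$: - $h:\mathbb{R}^n\to\mathbb{R}\cup\{+\infty\}$ is a Legendre function: proper, lower semicontinuous, strictly convex, continuously differentiable on $\operatorname{int}\operatorname{dom}(h)\ne\emptyset$, and essentially smooth ($\|\nabla h(x_k)\|\to\infty$ whenever $x_k\in\operatorname{int}\operatorname{dom}(h)$ converges to a boundary point of $\operatorname{dom}(h)$). Its Bregman distance is $D_h(x,y)=h(x)-h(y)-\langle\nabla h(y),x-y\rangle$ for $y\in\operatorname{int}\operatorname{dom}(h)$. - $f:\mathbb{R}^n\to\mathbb{R}\cup\{+\infty\}$ is proper, nonsmooth, and $\rho$-weakly convex relative to $h$ for some $\rho>0$, i.e. $f+\rho h$ is convex. - $X\subseteq\operatorname{int}\operatorname{dom}(h)$ is nonempty, closed and convex. - The set of minimizers $\mathcal{X}^*=\operatorname{argmin}_{x\in X}f(x)$ is nonempty, with optimal value $f^*>-\infty$. - Sharpness error bound: $\mu>0$ and $\mu\operatorname{dist}(x;\mathcal{X}^* )\le f(x)-f^*$ for all $x\in X$. - Local Bregman growth: there are $\nu\in(0,1]$ and $G_h>0$ with $\inf_{y\in\operatorname{proj}_{\mathcal{X}^*}(x)}D_h(y,x)\le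 G_h\operatorname{dist}^{1+\nu}(x;\mathcal{X}^* )$ for all $x\in X$ with $\operatorname{dist}(x;\mathcal{X}^* )<(\mu/(\rho G_h))^{1/\nu}$. For $\beta\in(0,1]$, $\mathcal{T}_\beta:=\{x\in X:\operatorname{dist}(x;\mathcal{X}^* )<(\beta\mu/(\rho G_h))^{1/\nu}\}$. Further, $L:=\sup\{\|\zeta\|:\zeta\in\partial f(x),\,x\in\mathcal{T}_1\}$ and $\tau:=\mu/L$. PSGA (projected subgradient algorithm): given $\beta\in(0,1)$, $x_0\in\mathcal{T}_\beta$ and step-sizes $\alpha_k>0$, for $k=0,1,2,\dots$ choose $\zeta_k\in\partial f(x_k)$ and set $x_{k+1}=\operatorname{proj}_X\big(x_k-\alpha_k\zeta_k/\|\zeta_k\|\big)$ (with $x_{k+1}=x_k$ if $\zeta_k=0$).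
   Formalization: The claim q>0 is asserted only when X* ≠ X; if every point of X is a minimizer it can fail (e.g. X={0}, f=ε|x|, h=x²/2, μ large, maximal α). The distance inequality is stated in all cases. *)

theory Defs
  imports "HOL-Analysis.Analysis"
begin

definition edom :: "('a \<Rightarrow> ereal) \<Rightarrow> 'a set" where
  "edom f = {x. f x < \<infinity>}"

definition proper_fun :: "('a \<Rightarrow> ereal) \<Rightarrow> bool" where
  "proper_fun f \<longleftrightarrow> (\<forall>x. f x \<noteq> -\<infinity>) \<and> edom f \<noteq> {}"

definition lower_semicont :: "('a::topological_space \<Rightarrow> ereal) \<Rightarrow> bool" where
  "lower_semicont f \<longleftrightarrow> (\<forall>x. f x \<le> Liminf (at x) f)"

(* Both convexity notions are meant for functions that do not take the value -\<infinity>, so that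
   the sum on the right-hand side never has the form \<infinity> - \<infinity>. *)
definition ereal_convex :: "('a::real_vector \<Rightarrow> ereal) \<Rightarrow> bool" where
  "ereal_convex f \<longleftrightarrow> (\<forall>x y t. 0 < t \<and> t < 1 \<longrightarrow>
     f ((1 - t) *\<^sub>R x + t *\<^sub>R y) \<le> ereal (1 - t) * f x + ereal t * f y)"

definition ereal_strictly_convex :: "('a::real_vector \<Rightarrow> ereal) \<Rightarrow> bool" where
  "ereal_strictly_convex f \<longleftrightarrow>
     (\<forall>x\<in>edom f. \<forall>y\<in>edom f. \<forall>t. x \<noteq> y \<and> 0 < t \<and> t < 1 \<longrightarrow>
        f ((1 - t) *\<^sub>R x + t *\<^sub>R y) < ereal (1 - t) * f x + ereal t * f y)"

(* The gradient of an extended-real-valued function; only meaningful at interior points of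
   the effective domain at which the function is differentiable. *)
definition grad :: "('a::real_inner \<Rightarrow> ereal) \<Rightarrow> 'a \<Rightarrow> 'a" where
  "grad h x = (THE d. GDERIV (\<lambda>y. real_of_ereal (h y)) x :> d)"

definition legendre :: "('a::real_inner \<Rightarrow> ereal) \<Rightarrow> bool" where
  "legendre h \<longleftrightarrow>
     proper_fun h \<and> lower_semicont h \<and> ereal_strictly_convex h \<and>
     interior (edom h) \<noteq> {} \<and>
     (\<forall>x\<in>interior (edom h). \<exists>d. GDERIV (\<lambda>y. real_of_ereal (h y)) x :> d) \<and>
     continuous_on (interior (edom h)) (grad h) \<and>
     (\<forall>u z. (\<forall>k. u k \<in> interior (edom h)) \<and> u \<longlonglongrightarrow> z \<and> z \<in> frontier (edom h)
        \<longrightarrow> filterlim (\<lambda>k. norm (grad h (u k))) at_top sequentially)"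

(* Meaningful for y in the interior of the effective domain of h. *)
definition bregman :: "('a::real_inner \<Rightarrow> ereal) \<Rightarrow> 'a \<Rightarrow> 'a \<Rightarrow> ereal" where
  "bregman h x y = h x - h y - ereal (inner (grad h y) (x - y))"

definition rel_weakly_convex ::
    "real \<Rightarrow> ('a::real_vector \<Rightarrow> ereal) \<Rightarrow> ('a \<Rightarrow> ereal) \<Rightarrow> bool" where
  "rel_weakly_convex \<rho> h f \<longleftrightarrow> ereal_convex (\<lambda>x. f x + ereal \<rho> * h x)"

(* f y >= f x + <\<zeta>, y - x> + o(|y - x|), with the remainder written out as an epsilon
   condition. As usual, the subdifferential is empty at points where f is not finite. *)
definition frechet_subdiff :: "('a::real_inner \<Rightarrow> ereal) \<Rightarrow> 'a \<Rightarrow> 'a set" where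
  "frechet_subdiff f x = {\<zeta>. \<bar>f x\<bar> \<noteq> \<infinity> \<and>
     (\<forall>\<epsilon>>0. \<forall>\<^sub>F y in at x.
        f x + ereal (inner \<zeta> (y - x) - \<epsilon> * norm (y - x)) \<le> f y)}"

definition argmin :: "('a \<Rightarrow> 'b::linorder) \<Rightarrow> 'a set \<Rightarrow> 'a set" where
  "argmin f S = {x. is_arg_min f (\<lambda>z. z \<in> S) x}"

definition proj :: "'a::real_normed_vector set \<Rightarrow> 'a \<Rightarrow> 'a set" where
  "proj S x = argmin (\<lambda>z. norm (z - x)) S"

(* A run of the projected subgradient algorithm: iterates x, chosen subgradients \<zeta>,
   step-sizes \<alpha>. For closed convex nonempty X the set proj X is a singleton, so
   membership determines the next iterate. *)
definition psga :: "('a::real_inner \<Rightarrow> ereal) \<Rightarrow> 'a set \<Rightarrow> (nat \<Rightarrow> real) \<Rightarrow>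
    (nat \<Rightarrow> 'a) \<Rightarrow> (nat \<Rightarrow> 'a) \<Rightarrow> bool" where
  "psga f X \<alpha> x \<zeta> \<longleftrightarrow> (\<forall>k. \<alpha> k > 0 \<and> \<zeta> k \<in> frechet_subdiff f (x k) \<and>
     (if \<zeta> k = 0 then x (Suc k) = x k
      else x (Suc k) \<in> proj X (x k - (\<alpha> k / norm (\<zeta> k)) *\<^sub>R \<zeta> k)))"

(* The tube T_\<beta> around the set Xs of minimizers. *)
definition tube :: "'a::metric_space set \<Rightarrow> 'a set \<Rightarrow> real \<Rightarrow> real \<Rightarrow> real \<Rightarrow> real \<Rightarrow> real \<Rightarrow> 'a set" where
  "tube X Xs \<mu> \<rho> G \<nu> \<beta> = {x\<in>X. infdist x Xs < (\<beta> * \<mu> / (\<rho> * G)) powr (1 / \<nu>)}"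

(* The supremum L is taken in the extended reals, since subgradients may be unbounded. *)
definition subgrad_sup :: "('a::real_inner \<Rightarrow> ereal) \<Rightarrow> 'a set \<Rightarrow> ereal" where
  "subgrad_sup f T = (SUP \<zeta>\<in>(\<Union>x\<in>T. frechet_subdiff f x). ereal (norm \<zeta>))"

(* \<tau> = \<mu> / L. This is 0 if L = \<infinity>. For L = 0 the quotient is not defined
   mathematically; the conversion to real then also yields 0. In both cases there is no
   positive step-size satisfying the upper bound required of it. *)
definition condition_ratio :: "real \<Rightarrow> ereal \<Rightarrow> real" where
  "condition_ratio \<mu> L = real_of_ereal (ereal \<mu> / L)"

end

theory Submission
  imports Defs
begin

text \<open>Since f + \<rho>h is convex, a Frechet subgradient \<zeta> at x satisfies the global inequality
  f y \<ge> f x + \<langle>\<zeta>, y - x\<rangle> - \<rho> D_h(y, x). Evaluated at a minimizer y nearest to x,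
  sharpness and the growth bound turn it into \<langle>\<zeta>, x - y\<rangle> \<ge> (1 - \<beta>) \<mu> d for the distance d of x,
  which makes a projected step obey d_+^2 \<le> d^2 - 2 \<alpha> (1 - \<beta>) \<tau> d + \<alpha>^2. If d \<ge> D the quantity
  d^2 - D^2 contracts by q; if d < D the new value is at most \<alpha>^2, and the step-size bound, which says
  D^2 + \<alpha>^2 \<le> R^2 for the radius R of the tube, keeps the iterates inside.

  Positivity of q needs (1 - \<beta>) \<tau> \<le> 1, that is, a subgradient at a point of the tube that is not a
  minimizer. It exists because finiteness of L forces points with subgradients into the interior of the
  domain of f.\<close>

section \<open>Convex analysis: normals, subgradients, projections\<close>

text \<open>If \<open>C\<close> has empty interior, it lies in a hyperplane, whose normal is
  oriented by the side on which \<open>x\<close> lies. Otherwise \<open>x\<close> is separated from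
  the interior, and taking closures carries the inequality over to \<open>C\<close>.\<close>

lemma exists_normal_notin_interior:
  fixes C :: "'a::euclidean_space set"
  assumes "convex C" "x \<notin> interior C"
  shows "\<exists>a. a \<noteq> 0 \<and> (\<forall>y\<in>C. a \<bullet> (y - x) \<le> 0)"
proof (cases "interior C = {}")
  case True
  then obtain a b where ab: "a \<noteq> 0" "C \<subseteq> {x. a \<bullet> x = b}"
    using empty_interior_subset_hyperplane[OF assms(1)] by metis
  show ?thesis
  proof (cases "b \<le> a \<bullet> x")
    case True
    then show ?thesis using ab by (intro exI[of _ a]) (auto simp: inner_diff_right)
  next
    case False
    then show ?thesis using ab by (intro exI[of _ "-a"]) (auto simp: inner_diff_right)
  qed
next
  case False
  then obtain a b where a: "a \<noteq> 0" and b: "\<forall>y\<in>{x}. a \<bullet> y \<le> b" "\<forall>y\<in>interior C. a \<bullet> y \<ge> b"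
    using separating_hyperplane_sets[of "{x}" "interior C"] assms convex_interior by blast
  have "closure (interior C) \<subseteq> {y. b \<le> a \<bullet> y}"
    by (rule closure_minimal) (use b closed_halfspace_ge[of b a] in auto)
  then have "C \<subseteq> {y. b \<le> a \<bullet> y}"
    using convex_closure_interior[OF assms(1) False] closure_subset[of C] by auto
  then show ?thesis using a b by (intro exI[of _ "-a"]) (auto simp: inner_diff_right)
qed

text \<open>Support the epigraph at \<open>(x, F x)\<close>. The supporting hyperplane is not
  vertical, because a small move from \<open>x\<close> along \<open>u\<close> stays in
  \<open>C\<close>; so its normal rescales to a slope.\<close>

lemma convex_on_exists_subgradient:
  fixes F :: "'a::euclidean_space \<Rightarrow> real"
  assumes F: "convex_on C F" and x: "x \<in> interior C"
  shows "\<exists>u. \<forall>y\<in>C. F x + u \<bullet> (y - x) \<le> F y"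
proof -
  have "(x, F x) \<notin> interior (epigraph C F)"
  proof
    assume "(x, F x) \<in> interior (epigraph C F)"
    then obtain e where e: "e > 0" "cball (x, F x) e \<subseteq> epigraph C F"
      unfolding mem_interior_cball by blast
    have "(x, F x - e) \<in> cball (x, F x) e"
      using e(1) by (auto simp: dist_Pair_Pair dist_real_def)
    then show False using e by (auto simp: mem_epigraph)
  qed
  then obtain u b where ub: "(u, b) \<noteq> 0" "\<And>p. p \<in> epigraph C F \<Longrightarrow> (u, b) \<bullet> (p - (x, F x)) \<le> 0"
    using exists_normal_notin_interior[OF convex_epigraphI[OF F]] by (metis surj_pair)
  have xC: "x \<in> C" using x interior_subset by blast
  have ineq: "u \<bullet> (y - x) + b * (F y - F x) \<le> 0" if "y \<in> C" for y
    using ub(2)[of "(y, F y)"] that by (auto simp: mem_epigraph inner_Pair)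
  have b0: "b \<le> 0"
    using ub(2)[of "(x, F x + 1)"] xC by (auto simp: mem_epigraph inner_Pair)
  have "b \<noteq> 0"
  proof
    assume b: "b = 0"
    then have u: "u \<noteq> 0" using ub(1) by (auto simp: zero_prod_def)
    obtain e where e: "e > 0" "cball x e \<subseteq> C"
      using x unfolding mem_interior_cball by blast
    have "x + (e / norm u) *\<^sub>R u \<in> C"
      using e u by (auto simp: subset_iff dist_norm)
    from ineq[OF this] have "e / norm u * (u \<bullet> u) \<le> 0" using b by simp
    moreover have "e / norm u * (u \<bullet> u) > 0" using e u by simp
    ultimately show False by simp
  qed
  then have b1: "b < 0" using b0 by simp
  have "F x + (u /\<^sub>R (-b)) \<bullet> (y - x) \<le> F y" if "y \<in> C" for y
    using ineq[OF that] b1 by (simp add: field_simps)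
  then show ?thesis by blast
qed

text \<open>The projection is nonexpansive and fixes \<open>y\<close>.\<close>

lemma proj_dist_le:
  fixes S :: "'a::euclidean_space set"
  assumes "closed S" "convex S" "p \<in> proj S a" "y \<in> S"
  shows "norm (p - y) \<le> norm (a - y)"
proof -
  have p: "p \<in> S" "\<And>z. z \<in> S \<Longrightarrow> norm (p - a) \<le> norm (z - a)"
    using assms(3) by (auto simp: proj_def argmin_def is_arg_min_def not_less)
  have "p = closest_point S a"
    using p by (intro closest_point_unique[OF assms(2,1)]) (auto simp: dist_norm norm_minus_commute)
  moreover have "closest_point S y = y"
    using closest_point_self assms by blast
  ultimately show ?thesis
    using closest_point_lipschitz[OF assms(2,1), of a y] assms(4) by (auto simp: dist_norm)
qed

section \<open>Subgradients of relatively weakly convex functions\<close>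

locale relatively_weakly_convex =
  fixes h f :: "'a::euclidean_space \<Rightarrow> ereal" and \<rho> :: real
  assumes legendre: "legendre h"
    and proper: "proper_fun f"
    and rho_pos: "\<rho> > 0"
    and weakly_convex: "rel_weakly_convex \<rho> h f"
begin

text \<open>This is the effective domain of f + \<rho>h, where its convexity can be stated with real
  values.\<close>

definition dom :: "'a set" where
  "dom = edom f \<inter> edom h"

definition fr :: "'a \<Rightarrow> real" where
  "fr y = real_of_ereal (f y)"

definition hr :: "'a \<Rightarrow> real" where
  "hr y = real_of_ereal (h y)"

definition breg :: "'a \<Rightarrow> 'a \<Rightarrow> real" where
  "breg y x = hr y - hr x - grad h x \<bullet> (y - x)"

lemma f_eq: "y \<in> edom f \<Longrightarrow> f y = ereal (fr y)"
  using proper unfolding fr_def proper_fun_def edom_def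
  by (cases "f y") auto

lemma h_eq: "y \<in> edom h \<Longrightarrow> h y = ereal (hr y)"
  using legendre unfolding hr_def legendre_def proper_fun_def edom_def
  by (cases "h y") auto

lemma f_eq_infinity: "y \<notin> edom f \<Longrightarrow> f y = \<infinity>"
  by (simp add: edom_def)

lemma bregman_eq:
  assumes "y \<in> edom h" "x \<in> edom h"
  shows "bregman h y x = ereal (breg y x)"
  using assms by (simp add: bregman_def breg_def h_eq)

lemma convex_on_sum: "convex_on dom (\<lambda>y. fr y + \<rho> * hr y)"
  and convex_dom: "convex dom"
proof -
  have key: "(1 - t) *\<^sub>R x + t *\<^sub>R y \<in> dom \<and>
      fr ((1 - t) *\<^sub>R x + t *\<^sub>R y) + \<rho> * hr ((1 - t) *\<^sub>R x + t *\<^sub>R y)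
        \<le> (1 - t) * (fr x + \<rho> * hr x) + t * (fr y + \<rho> * hr y)"
    if xy: "x \<in> dom" "y \<in> dom" "0 < t" "t < 1" for x y t
  proof -
    let ?z = "(1 - t) *\<^sub>R x + t *\<^sub>R y"
    have "f ?z + ereal \<rho> * h ?z
        \<le> ereal (1 - t) * (f x + ereal \<rho> * h x) + ereal t * (f y + ereal \<rho> * h y)"
      using weakly_convex that unfolding rel_weakly_convex_def ereal_convex_def by blast
    also have "\<dots> = ereal ((1 - t) * (fr x + \<rho> * hr x) + t * (fr y + \<rho> * hr y))"
      using xy by (simp add: dom_def f_eq h_eq)
    finally have le: "f ?z + ereal \<rho> * h ?z
        \<le> ereal ((1 - t) * (fr x + \<rho> * hr x) + t * (fr y + \<rho> * hr y))" .
    have "f ?z \<noteq> -\<infinity>" "h ?z \<noteq> -\<infinity>"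
      using proper legendre by (auto simp: proper_fun_def legendre_def)
    \<comment> \<open>The sum is bounded above by a real number and neither summand is -\<infinity>,
      so both are finite.\<close>
    then have "?z \<in> edom f" "?z \<in> edom h"
      using le rho_pos unfolding edom_def by (cases "f ?z"; cases "h ?z"; auto)+
    then show ?thesis using le by (auto simp: dom_def f_eq h_eq)
  qed
  show cd: "convex dom"
    unfolding convex_alt using key by (metis less_eq_real_def scale_zero_left add.left_neutral
        add.right_neutral diff_zero diff_self scale_one)
  show "convex_on dom (\<lambda>y. fr y + \<rho> * hr y)"
    by (rule convex_onI) (use key cd in auto)
qed

text \<open>\<open>grad\<close> is a definite description, so uniqueness of the gradient is needed
  besides existence.\<close>

lemma gderiv_hr:
  assumes "x \<in> interior (edom h)"
  shows "GDERIV hr x :> grad h x"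
proof -
  have hr: "hr = (\<lambda>y. real_of_ereal (h y))" by (auto simp: hr_def)
  obtain d where d: "GDERIV hr x :> d"
    using legendre assms unfolding legendre_def hr by blast
  have "d' = d" if "GDERIV hr x :> d'" for d'
    using has_derivative_unique[of hr _ x] d that unfolding gderiv_def
    by (metis vector_eq_ldot inner_commute)
  then show ?thesis using d unfolding grad_def hr by (metis theI)
qed

text \<open>\<open>breg y x\<close> is the first-order Taylor remainder of \<open>hr\<close> at
  \<open>x\<close>.\<close>

lemma breg_small_o:
  assumes "x \<in> interior (edom h)" "e > 0"
  shows "\<forall>\<^sub>F y in at x. \<bar>breg y x\<bar> \<le> e * norm (y - x)"
  using gderiv_hr[OF assms(1)] assms(2)
  unfolding gderiv_def has_derivative_within_alt2 breg_def
  by (auto simp: inner_commute)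

lemma frechet_subdiff_imp_edom:
  assumes "\<zeta> \<in> frechet_subdiff f x" shows "x \<in> edom f"
  using assms by (auto simp: frechet_subdiff_def edom_def)

text \<open>Close to \<open>x\<close> on the segment to \<open>y\<close>, the Frechet inequality and
  the smallness of the Bregman term bound f + \<rho>h from below to first order; convexity bounds it
  from above by the chord. Division by \<open>t\<close> makes the comparison global.\<close>

lemma subgradient_inequality:
  assumes x: "x \<in> interior (edom h)" and z: "\<zeta> \<in> frechet_subdiff f x" and y: "y \<in> dom"
  shows "fr x + \<zeta> \<bullet> (y - x) - \<rho> * breg y x \<le> fr y"
proof (cases "y = x")
  case True
  then show ?thesis by (simp add: breg_def)
next
  case False
  have xd: "x \<in> dom"
    using x frechet_subdiff_imp_edom[OF z] interior_subset by (auto simp: dom_def)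
  have n: "norm (y - x) > 0" using False by simp
  show ?thesis
  proof (rule field_le_epsilon)
    fix e :: real assume e: "e > 0"
    \<comment> \<open>The error left after division by \<open>t\<close> is (1 + \<rho>) \<epsilon>
      times the norm of \<open>y - x\<close>: one \<epsilon> from the subgradient, \<rho>\<epsilon>
      from the Bregman term. It is to equal \<open>e\<close>.\<close>
    define \<epsilon> where "\<epsilon> = e / ((1 + \<rho>) * norm (y - x))"
    have eps: "\<epsilon> > 0" using e n rho_pos by (simp add: \<epsilon>_def)
    have "\<forall>\<^sub>F w in at x. f x + ereal (\<zeta> \<bullet> (w - x) - \<epsilon> * norm (w - x)) \<le> f w
        \<and> \<bar>breg w x\<bar> \<le> \<epsilon> * norm (w - x)"
      using z eps breg_small_o[OF x eps] by (auto simp: frechet_subdiff_def eventually_conj_iff)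
    then obtain d where d: "d > 0"
      and ev: "\<And>w. w \<noteq> x \<Longrightarrow> dist w x < d \<Longrightarrow> f x + ereal (\<zeta> \<bullet> (w - x) - \<epsilon> * norm (w - x)) \<le> f w
        \<and> \<bar>breg w x\<bar> \<le> \<epsilon> * norm (w - x)"
      unfolding eventually_at by blast
    define t where "t = min (1/2) (d / (2 * norm (y - x)))"
    have t: "0 < t" "t < 1" using d n by (auto simp: t_def)
    define w where "w = (1 - t) *\<^sub>R x + t *\<^sub>R y"
    have wx: "w - x = t *\<^sub>R (y - x)" by (simp add: w_def algebra_simps)
    have "t * norm (y - x) \<le> d / (2 * norm (y - x)) * norm (y - x)"
      using n by (intro mult_right_mono) (auto simp: t_def)
    also have "\<dots> < d" using d n by simp
    finally have "dist w x < d" using t by (simp add: dist_norm wx)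
    moreover have "w \<noteq> x" using wx t False by auto
    moreover have wd: "w \<in> dom"
      using convex_dom xd y t unfolding convex_alt w_def by auto
    ultimately have 1: "fr x + t * (\<zeta> \<bullet> (y - x)) - \<epsilon> * (t * norm (y - x)) \<le> fr w"
      and 2: "\<bar>breg w x\<bar> \<le> \<epsilon> * (t * norm (y - x))"
      using ev[of w] xd t by (auto simp: wx f_eq dom_def)
    have 3: "fr w + \<rho> * hr w \<le> (1 - t) * (fr x + \<rho> * hr x) + t * (fr y + \<rho> * hr y)"
      using convex_onD[OF convex_on_sum, of t x y] xd y t by (simp add: w_def)
    have "hr x + t * (grad h x \<bullet> (y - x)) - \<epsilon> * (t * norm (y - x)) \<le> hr w"
      using 2 by (simp add: breg_def wx)
    then have "\<rho> * (hr x + t * (grad h x \<bullet> (y - x)) - \<epsilon> * (t * norm (y - x))) \<le> \<rho> * hr w"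
      using rho_pos by simp
    with 1 3 have "t * (\<zeta> \<bullet> (y - x) + \<rho> * (grad h x \<bullet> (y - x)) - (1 + \<rho>) * \<epsilon> * norm (y - x))
        \<le> t * (fr y + \<rho> * hr y - fr x - \<rho> * hr x)"
      by (simp add: algebra_simps)
    then have "\<zeta> \<bullet> (y - x) + \<rho> * (grad h x \<bullet> (y - x)) - (1 + \<rho>) * \<epsilon> * norm (y - x)
        \<le> fr y + \<rho> * hr y - fr x - \<rho> * hr x"
      using t by simp
    moreover have "(1 + \<rho>) * \<epsilon> * norm (y - x) = e"
      using n rho_pos by (simp add: \<epsilon>_def)
    ultimately show "fr x + \<zeta> \<bullet> (y - x) - \<rho> * breg y x \<le> fr y + e"
      by (simp add: breg_def algebra_simps)
  qed
qed

text \<open>The converse: the Bregman term is absorbed by the o-term, and points near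
  \<open>x\<close> outside \<open>dom\<close> have f = \<infinity>.\<close>

lemma frechet_subdiffI:
  assumes x: "x \<in> interior (edom h)" "x \<in> edom f"
    and ineq: "\<And>y. y \<in> dom \<Longrightarrow> fr x + \<zeta> \<bullet> (y - x) - \<rho> * breg y x \<le> fr y"
  shows "\<zeta> \<in> frechet_subdiff f x"
  unfolding frechet_subdiff_def
proof (intro CollectI conjI allI impI)
  show "\<bar>f x\<bar> \<noteq> \<infinity>" using f_eq[OF x(2)] by simp
  fix e :: real assume e: "e > 0"
  have "\<forall>\<^sub>F y in at x. \<bar>breg y x\<bar> \<le> e / \<rho> * norm (y - x)"
    using breg_small_o[OF x(1), of "e / \<rho>"] e rho_pos by simp
  moreover have "\<forall>\<^sub>F y in at x. y \<in> interior (edom h)"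
    using x(1) eventually_at_in_open' open_interior by blast
  ultimately show "\<forall>\<^sub>F y in at x. f x + ereal (\<zeta> \<bullet> (y - x) - e * norm (y - x)) \<le> f y"
  proof eventually_elim
    case (elim y)
    show ?case
    proof (cases "y \<in> edom f")
      case True
      then have "y \<in> dom" using elim interior_subset by (auto simp: dom_def)
      moreover have "\<rho> * breg y x \<le> e * norm (y - x)"
      proof -
        have "\<rho> * breg y x \<le> \<rho> * (e / \<rho> * norm (y - x))"
          using elim rho_pos by (intro mult_left_mono) auto
        then show ?thesis using rho_pos by simp
      qed
      ultimately show ?thesis using ineq[of y] by (simp add: f_eq x True)
    qed (simp add: f_eq_infinity)
  qed
qed

lemma exists_subgradient:
  assumes x: "x \<in> interior (edom h)" "x \<in> interior dom"
  shows "frechet_subdiff f x \<noteq> {}"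
proof -
  obtain u where u: "\<forall>y\<in>dom. fr x + \<rho> * hr x + u \<bullet> (y - x) \<le> fr y + \<rho> * hr y"
    using convex_on_exists_subgradient[OF convex_on_sum x(2)] by blast
  \<comment> \<open>Subtracting the smooth part turns a subgradient of f + \<rho>h into one of
    f.\<close>
  have "u - \<rho> *\<^sub>R grad h x \<in> frechet_subdiff f x"
  proof (rule frechet_subdiffI)
    show "x \<in> edom f" using x interior_subset by (auto simp: dom_def)
    fix y assume "y \<in> dom"
    then show "fr x + (u - \<rho> *\<^sub>R grad h x) \<bullet> (y - x) - \<rho> * breg y x \<le> fr y"
      using u by (force simp: breg_def algebra_simps)
  qed fact
  then show ?thesis by blast
qed

text \<open>Off the interior, a normal vector of the domain can be added to any subgradient.\<close>

lemma bounded_subdiff_imp_interior_dom: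
  assumes x: "x \<in> interior (edom h)" and z: "\<zeta> \<in> frechet_subdiff f x"
    and bd: "\<And>\<xi>. \<xi> \<in> frechet_subdiff f x \<Longrightarrow> norm \<xi> \<le> B"
  shows "x \<in> interior dom"
proof (rule ccontr)
  assume "x \<notin> interior dom"
  then obtain a where a: "a \<noteq> 0" "\<And>y. y \<in> dom \<Longrightarrow> a \<bullet> (y - x) \<le> 0"
    using exists_normal_notin_interior[OF convex_dom] by blast
  \<comment> \<open>With this length of \<open>s *\<^sub>R a\<close> the shifted subgradient has
    norm at least B + 1.\<close>
  define s where "s = (B + norm \<zeta> + 1) / norm a"
  have B: "B \<ge> 0" using bd[OF z] norm_ge_zero[of \<zeta>] by linarith
  then have s: "s \<ge> 0" by (simp add: s_def)
  have "\<zeta> + s *\<^sub>R a \<in> frechet_subdiff f x"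
  proof (rule frechet_subdiffI[OF x frechet_subdiff_imp_edom[OF z]])
    fix y assume y: "y \<in> dom"
    have "s * (a \<bullet> (y - x)) \<le> 0" using a(2)[OF y] s by (simp add: mult_nonneg_nonpos)
    then show "fr x + (\<zeta> + s *\<^sub>R a) \<bullet> (y - x) - \<rho> * breg y x \<le> fr y"
      using subgradient_inequality[OF x z y] by (simp add: inner_add_left)
  qed
  then have "norm (\<zeta> + s *\<^sub>R a) \<le> B" using bd by blast
  moreover have "norm (s *\<^sub>R a) = B + norm \<zeta> + 1" using a B by (simp add: s_def)
  moreover have "norm (s *\<^sub>R a) \<le> norm (\<zeta> + s *\<^sub>R a) + norm \<zeta>"
    using norm_triangle_ineq[of "\<zeta> + s *\<^sub>R a" "-\<zeta>"] by simp
  ultimately show False by simp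
qed

text \<open>The global inequality passes to the limit, since \<open>hr\<close> and
  \<open>grad h\<close> are continuous at \<open>x\<close>. The constant value of f along
  \<open>w\<close> stands in for its continuity; it is available along minimizers.\<close>

lemma subgradient_limit:
  assumes w: "w \<longlonglongrightarrow> x" "\<And>n. w n \<in> interior (edom h)" "\<And>n. f (w n) = f x"
    and z: "z \<longlonglongrightarrow> \<zeta>" "\<And>n. z n \<in> frechet_subdiff f (w n)"
    and x: "x \<in> interior (edom h)"
  shows "\<zeta> \<in> frechet_subdiff f x"
proof (rule frechet_subdiffI[OF x])
  show "x \<in> edom f"
    using frechet_subdiff_imp_edom[OF z(2)[of 0]] w(3)[of 0] by (simp add: edom_def)
  fix y assume y: "y \<in> dom"
  have "continuous (at x) hr"
    using gderiv_hr[OF x] unfolding gderiv_def by (rule has_derivative_continuous)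
  then have 1: "(\<lambda>n. hr (w n)) \<longlonglongrightarrow> hr x"
    using w(1) unfolding continuous_at using tendsto_at_iff_tendsto_nhds
      filterlim_compose by blast
  have 2: "(\<lambda>n. grad h (w n)) \<longlonglongrightarrow> grad h x"
    using legendre w(1,2) x unfolding legendre_def
    by (intro continuous_on_tendsto_compose[of "interior (edom h)" "grad h"]) auto
  have "(\<lambda>n. fr x + z n \<bullet> (y - w n) - \<rho> * breg y (w n))
      \<longlonglongrightarrow> fr x + \<zeta> \<bullet> (y - x) - \<rho> * breg y x"
    unfolding breg_def by (intro tendsto_intros 1 2 z w(1))
  then show "fr x + \<zeta> \<bullet> (y - x) - \<rho> * breg y x \<le> fr y"
  proof (rule LIMSEQ_le_const2, intro exI allI impI)
    fix n
    show "fr x + z n \<bullet> (y - w n) - \<rho> * breg y (w n) \<le> fr y"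
      using subgradient_inequality[OF w(2) z(2) y, of n] w(3)[of n] by (simp add: fr_def)
  qed
qed

end

section \<open>The scalar recursion for the distances\<close>

text \<open>Here c is (1 - \<beta>)\<tau> and R the tube radius. D is the distance at which the
  decrease 2\<alpha>cd balances the error \<open>\<alpha>\<^sup>2\<close>.\<close>

lemma one_step_bound:
  fixes d c \<alpha> R d' :: real
  assumes d: "0 \<le> d" "d < R" and c: "0 < c" and a: "0 < \<alpha>"
    and R: "(\<alpha> / (2 * c))\<^sup>2 + \<alpha>\<^sup>2 \<le> R\<^sup>2"
    and step: "d'\<^sup>2 \<le> d\<^sup>2 - 2 * \<alpha> * c * d + \<alpha>\<^sup>2"
  defines "D \<equiv> \<alpha> / (2 * c)"
  shows "d'\<^sup>2 - D\<^sup>2 \<le> max ((1 - c * \<alpha> / R) * (d\<^sup>2 - D\<^sup>2)) (\<alpha>\<^sup>2)" "d'\<^sup>2 < R\<^sup>2"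
proof -
  have Dpos: "D > 0" using a c by (simp add: D_def)
  have aD: "\<alpha>\<^sup>2 = 2 * \<alpha> * c * D" using c by (simp add: D_def power2_eq_square)
  have R0: "R > 0" using d by simp
  have DR: "D\<^sup>2 + \<alpha>\<^sup>2 \<le> R\<^sup>2" using R by (simp add: D_def)
  have D2: "D\<^sup>2 > 0" using Dpos by simp
  have a2: "\<alpha>\<^sup>2 > 0" using a by simp
  have DltR: "D < R"
  proof (rule power_less_imp_less_base)
    show "D\<^sup>2 < R\<^sup>2" using DR a2 by linarith
  qed (use R0 in simp)
  have "(d'\<^sup>2 - D\<^sup>2 \<le> max ((1 - c * \<alpha> / R) * (d\<^sup>2 - D\<^sup>2)) (\<alpha>\<^sup>2)) \<and> d'\<^sup>2 < R\<^sup>2"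
  proof (cases "d \<ge> D")
    case True
    have "d\<^sup>2 - D\<^sup>2 = (d + D) * (d - D)" by (simp add: power2_eq_square algebra_simps)
    also have "\<dots> \<le> (2 * R) * (d - D)"
      using True d DltR by (intro mult_right_mono) auto
    finally have "c * \<alpha> / R * (d\<^sup>2 - D\<^sup>2) \<le> c * \<alpha> / R * ((2 * R) * (d - D))"
      using c a R0 by (intro mult_left_mono) auto
    also have "\<dots> = 2 * \<alpha> * c * (d - D)" using R0 by simp
    finally have "d'\<^sup>2 - D\<^sup>2 \<le> (1 - c * \<alpha> / R) * (d\<^sup>2 - D\<^sup>2)"
      using step aD by (simp add: algebra_simps)
    moreover have "d'\<^sup>2 \<le> d\<^sup>2"
    proof -
      have "2 * \<alpha> * c * D \<le> 2 * \<alpha> * c * d" using True a c by (intro mult_left_mono) auto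
      then show ?thesis using step aD by simp
    qed
    moreover have "d\<^sup>2 < R\<^sup>2" using d by (intro power_strict_mono) auto
    ultimately show ?thesis by auto
  next
    case False
    \<comment> \<open>The parabola is bounded by its values at the ends 0 and D. Beyond its root
      2\<alpha>c both factors of d(d - 2\<alpha>c) increase.\<close>
    have "d\<^sup>2 - 2 * \<alpha> * c * d \<le> max 0 (D\<^sup>2 - \<alpha>\<^sup>2)"
    proof (cases "d \<le> 2 * \<alpha> * c")
      case True
      then have "d * d \<le> (2 * \<alpha> * c) * d" using d by (intro mult_right_mono) auto
      then show ?thesis by (simp add: power2_eq_square)
    next
      case F: False
      have "d * (d - 2 * \<alpha> * c) \<le> D * (D - 2 * \<alpha> * c)"
        using F False d by (intro mult_mono) auto
      then show ?thesis unfolding aD by (simp add: power2_eq_square algebra_simps)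
    qed
    then have "d'\<^sup>2 \<le> max (\<alpha>\<^sup>2) (D\<^sup>2)" using step by linarith
    then show ?thesis using DR D2 a2 by linarith
  qed
  then show "d'\<^sup>2 - D\<^sup>2 \<le> max ((1 - c * \<alpha> / R) * (d\<^sup>2 - D\<^sup>2)) (\<alpha>\<^sup>2)" "d'\<^sup>2 < R\<^sup>2"
    by auto
qed

text \<open>The induction also carries \<open>d k < R\<close>, on which \<open>step\<close> depends.
  Multiplication by the factor preserves the maximum, as the factor lies between 0 and 1.\<close>

lemma constant_step_recursion:
  fixes d :: "nat \<Rightarrow> real" and c \<alpha> R :: real
  assumes d: "\<And>k. 0 \<le> d k" "d 0 < R" and c: "0 < c" and a: "0 < \<alpha>"
    and R: "(\<alpha> / (2 * c))\<^sup>2 + \<alpha>\<^sup>2 \<le> R\<^sup>2"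
    and step: "\<And>k. d k < R \<Longrightarrow> (d (Suc k))\<^sup>2 \<le> (d k)\<^sup>2 - 2 * \<alpha> * c * d k + \<alpha>\<^sup>2"
    and q: "0 \<le> 1 - c * \<alpha> / R"
  defines "D \<equiv> \<alpha> / (2 * c)"
  shows "(d k)\<^sup>2 - D\<^sup>2 \<le> max (((d 0)\<^sup>2 - D\<^sup>2) * (1 - c * \<alpha> / R) ^ k) (\<alpha>\<^sup>2)"
proof -
  let ?q = "1 - c * \<alpha> / R"
  have R0: "R > 0" using d(1)[of 0] d(2) by simp
  have "d k < R \<and> (d k)\<^sup>2 - D\<^sup>2 \<le> max (((d 0)\<^sup>2 - D\<^sup>2) * ?q ^ k) (\<alpha>\<^sup>2)"
  proof (induction k)
    case 0
    then show ?case using d by simp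
  next
    case (Suc k)
    note s = one_step_bound[OF d(1) conjunct1[OF Suc] c a R step[OF conjunct1[OF Suc]]]
    have "d (Suc k) < R"
      by (rule power_less_imp_less_base[OF s(2)]) (use R0 in simp)
    moreover have "?q * ((d k)\<^sup>2 - D\<^sup>2) \<le> max (((d 0)\<^sup>2 - D\<^sup>2) * ?q ^ Suc k) (\<alpha>\<^sup>2)"
    proof -
      have "?q * ((d k)\<^sup>2 - D\<^sup>2) \<le> ?q * max (((d 0)\<^sup>2 - D\<^sup>2) * ?q ^ k) (\<alpha>\<^sup>2)"
        using Suc q by (intro mult_left_mono) auto
      also have "\<dots> = max (((d 0)\<^sup>2 - D\<^sup>2) * ?q ^ Suc k) (?q * \<alpha>\<^sup>2)"
        using q by (simp add: max_mult_distrib_left mult_ac)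
      also have "\<dots> \<le> max (((d 0)\<^sup>2 - D\<^sup>2) * ?q ^ Suc k) (\<alpha>\<^sup>2)"
      proof -
        have "?q * \<alpha>\<^sup>2 \<le> 1 * \<alpha>\<^sup>2"
          using c a R0 by (intro mult_right_mono) auto
        then show ?thesis by (simp only: mult_1)
      qed
      finally show ?thesis .
    qed
    ultimately show ?case using s(1) unfolding D_def by linarith
  qed
  then show ?thesis by blast
qed

section \<open>Sharpness, the tube, and one step of PSGA\<close>

locale sharp_minimization = relatively_weakly_convex h f \<rho>
  for h f :: "'a::euclidean_space \<Rightarrow> ereal" and \<rho> +
  fixes X Xs :: "'a set" and m \<mu> \<nu> G :: real
  assumes X_subset: "X \<subseteq> interior (edom h)"
    and closed_X: "closed X"
    and convex_X: "convex X"
    and Xs_subset: "Xs \<subseteq> X"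
    and Xs_nonempty: "Xs \<noteq> {}"
    and min_value: "y \<in> Xs \<Longrightarrow> f y = ereal m"
    and sharp: "z \<in> X \<Longrightarrow> ereal (m + \<mu> * infdist z Xs) \<le> f z"
    and mu_pos: "\<mu> > 0"
    and nu_pos: "\<nu> > 0"
    and G_pos: "G > 0"
    and growth: "z \<in> X \<Longrightarrow> infdist z Xs < (\<mu> / (\<rho> * G)) powr (1 / \<nu>) \<Longrightarrow>
         (INF y\<in>proj Xs z. bregman h y z) \<le> ereal (G * infdist z Xs powr (1 + \<nu>))"
begin

abbreviation T :: "real \<Rightarrow> 'a set" where
  "T \<beta> \<equiv> tube X Xs \<mu> \<rho> G \<nu> \<beta>"

lemma tube_mono: "0 < \<beta> \<Longrightarrow> \<beta> \<le> 1 \<Longrightarrow> T \<beta> \<subseteq> T 1"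
  using mu_pos rho_pos G_pos nu_pos
  unfolding tube_def by (fastforce intro: less_le_trans powr_mono2 divide_right_mono)

lemma minimizers_subset_tube: "0 < \<beta> \<Longrightarrow> Xs \<subseteq> T \<beta>"
  using mu_pos rho_pos G_pos Xs_subset by (auto simp: tube_def)

text \<open>The \<nu>-th power undoes the exponent of the tube radius. This makes the growth term of
  order 1 + \<nu> linear in the distance, comparable with sharpness.\<close>

lemma growth_coefficient_le:
  assumes "z \<in> T \<beta>" "0 < \<beta>"
  shows "\<rho> * G * infdist z Xs powr \<nu> \<le> \<beta> * \<mu>"
proof -
  have "infdist z Xs powr \<nu> \<le> ((\<beta> * \<mu> / (\<rho> * G)) powr (1 / \<nu>)) powr \<nu>"
    using assms nu_pos by (intro powr_mono2) (auto simp: tube_def infdist_nonneg)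
  also have "\<dots> = \<beta> * \<mu> / (\<rho> * G)"
    using assms nu_pos mu_pos rho_pos G_pos by (simp add: powr_powr)
  finally show ?thesis using rho_pos G_pos by (simp add: field_simps)
qed

lemma norm_proj_minimizers:
  assumes "y \<in> proj Xs z"
  shows "y \<in> Xs" "norm (z - y) = infdist z Xs"
proof -
  have y: "y \<in> Xs" "\<And>w. w \<in> Xs \<Longrightarrow> dist z y \<le> dist z w"
    using assms by (auto simp: proj_def argmin_def is_arg_min_def not_less dist_norm norm_minus_commute)
  show "y \<in> Xs" by fact
  have "dist z y \<le> infdist z Xs"
    unfolding infdist_notempty[OF Xs_nonempty] using y Xs_nonempty by (intro cINF_greatest) auto
  then show "norm (z - y) = infdist z Xs"
    using infdist_le[OF y(1), of z] by (simp add: dist_norm)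
qed

text \<open>An infimum is approached only up to \<open>e\<close>. A nearest minimizer exists at all
  because the infimum over an empty projection would be \<infinity>.\<close>

lemma growth_near_inf:
  assumes "z \<in> T 1" "e > 0"
  obtains y where "y \<in> Xs" "norm (z - y) = infdist z Xs"
    "breg y z < G * infdist z Xs powr (1 + \<nu>) + e"
proof -
  have z: "z \<in> X" "infdist z Xs < (\<mu> / (\<rho> * G)) powr (1 / \<nu>)"
    using assms by (auto simp: tube_def)
  have "(INF y\<in>proj Xs z. bregman h y z) \<le> ereal (G * infdist z Xs powr (1 + \<nu>))"
    using growth[OF z] .
  also have "\<dots> < ereal (G * infdist z Xs powr (1 + \<nu>) + e)" using assms by simp
  finally obtain y where y: "y \<in> proj Xs z"
    "bregman h y z < ereal (G * infdist z Xs powr (1 + \<nu>) + e)"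
    unfolding INF_less_iff by blast
  moreover have "y \<in> edom h" "z \<in> edom h"
    using norm_proj_minimizers(1)[OF y(1)] z(1) Xs_subset X_subset interior_subset by blast+
  ultimately show ?thesis using that norm_proj_minimizers[OF y(1)] by (auto simp: bregman_eq)
qed

text \<open>At a limit point of \<open>Xs\<close> the distance is 0, and the growth bound supplies a
  nearest minimizer, which must be that point.\<close>

lemma closed_minimizers: "closed Xs"
proof -
  have "x \<in> Xs" if "x \<in> closure Xs" for x
  proof -
    have "x \<in> X" using that closure_minimal[OF Xs_subset closed_X] by blast
    moreover have d: "infdist x Xs = 0"
      using that Xs_nonempty by (simp add: in_closure_iff_infdist_zero)
    ultimately have "x \<in> T 1" using mu_pos rho_pos G_pos by (simp add: tube_def)
    then show ?thesis using growth_near_inf[of x 1] d by auto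
  qed
  then show ?thesis using closure_subset_eq by blast
qed

text \<open>The slack \<open>e\<close> comes from the infimum in the growth bound. \<open>y\<close>
  may vary with \<open>e\<close> but its distance from \<open>z\<close> does not, so users can let
  \<open>e\<close> tend to 0.\<close>

lemma subgradient_angle:
  assumes z: "z \<in> T \<beta>" and b: "0 < \<beta>" "\<beta> \<le> 1" and zeta: "\<zeta> \<in> frechet_subdiff f z" and e: "e > 0"
  obtains y where "y \<in> Xs" "norm (z - y) = infdist z Xs"
    "(1 - \<beta>) * \<mu> * infdist z Xs - e \<le> \<zeta> \<bullet> (z - y)"
proof -
  let ?d = "infdist z Xs"
  have zX: "z \<in> X" using z by (simp add: tube_def)
  obtain y where y: "y \<in> Xs" "norm (z - y) = ?d" "breg y z < G * ?d powr (1 + \<nu>) + e / \<rho>"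
    using growth_near_inf[OF subsetD[OF tube_mono[OF b] z] divide_pos_pos[OF e rho_pos]] .
  have "y \<in> edom f" using min_value[OF y(1)] by (simp add: edom_def)
  then have yd: "y \<in> dom" using y Xs_subset X_subset interior_subset by (auto simp: dom_def)
  have "\<rho> * breg y z \<le> \<rho> * (G * ?d powr (1 + \<nu>) + e / \<rho>)"
    using y(3) rho_pos by (intro mult_left_mono) auto
  also have "\<dots> = (\<rho> * G * ?d powr \<nu>) * ?d + e"
    using rho_pos by (simp add: powr_add infdist_nonneg algebra_simps)
  also have "\<dots> \<le> \<beta> * \<mu> * ?d + e"
    using growth_coefficient_le[OF z b(1)] by (intro add_right_mono mult_right_mono) (auto simp: infdist_nonneg)
  finally have 1: "\<rho> * breg y z \<le> \<beta> * \<mu> * ?d + e" .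
  have "fr z + \<zeta> \<bullet> (y - z) - \<rho> * breg y z \<le> fr y"
    using subgradient_inequality[OF _ zeta yd] zX X_subset by blast
  moreover have "fr y = m" using min_value[OF y(1)] by (simp add: fr_def)
  moreover have "m + \<mu> * ?d \<le> fr z"
    using sharp[OF zX] f_eq[OF frechet_subdiff_imp_edom[OF zeta]] by simp
  ultimately have "(1 - \<beta>) * \<mu> * ?d - e \<le> \<zeta> \<bullet> (z - y)"
    using 1 by (simp add: algebra_simps)
  with y that show ?thesis by blast
qed

text \<open>Cauchy-Schwarz in the angle estimate, then division by the distance, which is positive
  since \<open>Xs\<close> is closed.\<close>

lemma norm_subgradient_ge:
  assumes z: "z \<in> T \<beta>" "z \<notin> Xs" and b: "0 < \<beta>" "\<beta> \<le> 1" and zeta: "\<zeta> \<in> frechet_subdiff f z"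
  shows "(1 - \<beta>) * \<mu> \<le> norm \<zeta>"
proof -
  let ?d = "infdist z Xs"
  have d: "?d > 0"
    using closed_minimizers Xs_nonempty z(2) infdist_pos_not_in_closed by blast
  have "(1 - \<beta>) * \<mu> * ?d \<le> norm \<zeta> * ?d"
  proof (rule field_le_epsilon)
    fix e :: real assume "e > 0"
    from subgradient_angle[OF z(1) b zeta this] obtain y where
      "norm (z - y) = ?d" "(1 - \<beta>) * \<mu> * ?d - e \<le> \<zeta> \<bullet> (z - y)" by blast
    then show "(1 - \<beta>) * \<mu> * ?d \<le> norm \<zeta> * ?d + e"
      using norm_cauchy_schwarz[of \<zeta> "z - y"] by simp
  qed
  then show ?thesis using d by simp
qed

text \<open>So PSGA stalls only at minimizers.\<close>

lemma infdist_eq_0_if_zero_subgradient: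
  assumes z: "z \<in> T \<beta>" and b: "0 < \<beta>" "\<beta> < 1" and zeta: "0 \<in> frechet_subdiff f z"
  shows "infdist z Xs = 0"
  using norm_subgradient_ge[OF z _ b(1) _ zeta] b mu_pos
  by (cases "z \<in> Xs") (auto simp: mult_le_0_iff)

text \<open>Project without expansion, expand the square and insert the angle estimate; the
  normalized step contributes exactly \<open>\<alpha>\<^sup>2\<close>. Replacing the norm of \<zeta>
  by B only weakens the decrease.\<close>

lemma psga_step:
  assumes z: "z \<in> T \<beta>" and b: "0 < \<beta>" "\<beta> < 1" and zeta: "\<zeta> \<in> frechet_subdiff f z" "\<zeta> \<noteq> 0"
    and B: "norm \<zeta> \<le> B" and a: "\<alpha> > 0"
    and p: "p \<in> proj X (z - (\<alpha> / norm \<zeta>) *\<^sub>R \<zeta>)"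
  shows "(infdist p Xs)\<^sup>2 \<le> (infdist z Xs)\<^sup>2 - 2 * \<alpha> * ((1 - \<beta>) * (\<mu> / B)) * infdist z Xs + \<alpha>\<^sup>2"
proof -
  let ?d = "infdist z Xs" and ?n = "norm \<zeta>"
  have n: "?n > 0" using zeta by simp
  have "(infdist p Xs)\<^sup>2 \<le> ?d\<^sup>2 - 2 * \<alpha> / ?n * ((1 - \<beta>) * \<mu> * ?d) + \<alpha>\<^sup>2"
  proof (rule field_le_epsilon)
    fix e :: real assume e: "e > 0"
    \<comment> \<open>The slack becomes \<open>e\<close> after multiplication by 2\<alpha> /
      \<open>?n\<close>.\<close>
    obtain y where y: "y \<in> Xs" "norm (z - y) = ?d"
      "(1 - \<beta>) * \<mu> * ?d - e * ?n / (2 * \<alpha>) \<le> \<zeta> \<bullet> (z - y)"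
      using subgradient_angle[OF z b(1) less_imp_le[OF b(2)] zeta(1), of "e * ?n / (2 * \<alpha>)"] e n a by auto
    have "infdist p Xs \<le> norm (p - y)" using infdist_le[OF y(1), of p] by (simp add: dist_norm)
    also have "\<dots> \<le> norm ((z - (\<alpha> / ?n) *\<^sub>R \<zeta>) - y)"
      using y Xs_subset by (intro proj_dist_le[OF closed_X convex_X p]) auto
    finally have "(infdist p Xs)\<^sup>2 \<le> (norm ((z - y) - (\<alpha> / ?n) *\<^sub>R \<zeta>))\<^sup>2"
      by (intro power_mono) (auto simp: infdist_nonneg algebra_simps)
    also have "\<dots> = (norm (z - y))\<^sup>2 - 2 * ((z - y) \<bullet> ((\<alpha> / ?n) *\<^sub>R \<zeta>)) + (norm ((\<alpha> / ?n) *\<^sub>R \<zeta>))\<^sup>2"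
      by (simp only: power2_norm_eq_inner inner_diff inner_commute) simp
    also have "\<dots> = ?d\<^sup>2 - 2 * \<alpha> / ?n * (\<zeta> \<bullet> (z - y)) + \<alpha>\<^sup>2"
    proof -
      have "norm ((\<alpha> / ?n) *\<^sub>R \<zeta>) = \<alpha>" using a n by simp
      then show ?thesis by (simp only: y(2) inner_scaleR_right inner_commute[of "z - y"] mult.assoc
            times_divide_eq_left times_divide_eq_right)
    qed
    also have "\<dots> \<le> ?d\<^sup>2 - 2 * \<alpha> / ?n * ((1 - \<beta>) * \<mu> * ?d - e * ?n / (2 * \<alpha>)) + \<alpha>\<^sup>2"
      using y(3) a n by (intro add_right_mono diff_left_mono mult_left_mono) auto
    also have "\<dots> = ?d\<^sup>2 - 2 * \<alpha> / ?n * ((1 - \<beta>) * \<mu> * ?d) + \<alpha>\<^sup>2 + e"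
      using a n by (simp add: field_simps)
    finally show "(infdist p Xs)\<^sup>2 \<le> ?d\<^sup>2 - 2 * \<alpha> / ?n * ((1 - \<beta>) * \<mu> * ?d) + \<alpha>\<^sup>2 + e" .
  qed
  moreover have "2 * \<alpha> / B * ((1 - \<beta>) * \<mu> * ?d) \<le> 2 * \<alpha> / ?n * ((1 - \<beta>) * \<mu> * ?d)"
    using a b B n mu_pos less_le_trans[OF n B]
    by (intro mult_right_mono divide_left_mono mult_pos_pos) (auto simp: infdist_nonneg)
  ultimately show ?thesis by simp
qed

text \<open>If no point of the tube outside the minimizers lies in the interior of the domain, then the
  minimizers in that interior form a relatively clopen subset of X: closedness holds because a limit
  of bounded subgradients is again a subgradient, and bounded subdifferentials occur only in the
  interior.\<close>

lemma exists_non_minimizer_in_tube: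
  assumes b: "0 < \<beta>" and x0: "x0 \<in> Xs" "frechet_subdiff f x0 \<noteq> {}"
    and B: "\<And>z \<zeta>. z \<in> T 1 \<Longrightarrow> \<zeta> \<in> frechet_subdiff f z \<Longrightarrow> norm \<zeta> \<le> B"
    and ne: "Xs \<noteq> X"
  shows "\<exists>z \<in> T \<beta> - Xs. z \<in> interior dom"
proof (rule ccontr)
  assume no: "\<not> ?thesis"
  define A where "A = Xs \<inter> interior dom"
  have in_A: "z \<in> A" if "z \<in> Xs" "\<zeta> \<in> frechet_subdiff f z" for z \<zeta>
    using bounded_subdiff_imp_interior_dom[of z \<zeta> B] that B[of z]
      minimizers_subset_tube[of 1] Xs_subset X_subset unfolding A_def by auto
  have "x0 \<in> A" using in_A x0 by blast
  \<comment> \<open>By \<open>no\<close>, a tube point in the interior of \<open>dom\<close> is a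
    minimizer; hence A is the trace on X of an open set.\<close>
  have "A = X \<inter> ({z. infdist z Xs < (\<beta> * \<mu> / (\<rho> * G)) powr (1 / \<nu>)} \<inter> interior dom)"
    using no Xs_subset minimizers_subset_tube[OF b] unfolding A_def tube_def by blast
  moreover have "open {z. infdist z Xs < (\<beta> * \<mu> / (\<rho> * G)) powr (1 / \<nu>)}"
    by (intro open_Collect_less continuous_intros)
  ultimately have op: "openin (top_of_set X) A"
    using openin_open_Int[of _ X] open_Int open_interior by metis
  have "closed A"
    unfolding closed_sequential_limits
  proof (intro allI impI, elim conjE)
    fix w x assume w: "\<forall>n. w n \<in> A" "w \<longlonglongrightarrow> x"
    have x: "x \<in> Xs" using closed_minimizers w unfolding closed_sequential_limits A_def by blast
    have hint: "w n \<in> interior (edom h)" for n using w Xs_subset X_subset by (auto simp: A_def)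
    have "\<forall>n. \<exists>\<zeta>. \<zeta> \<in> frechet_subdiff f (w n)"
      using exists_subgradient hint w unfolding A_def by blast
    then obtain z where z: "\<And>n. z n \<in> frechet_subdiff f (w n)" by metis
    have "norm (z n) \<le> B" for n
      using B[OF _ z] w minimizers_subset_tube[of 1] by (auto simp: A_def)
    then have "bounded (range z)" by (auto simp: bounded_iff)
    then obtain l r where lr: "strict_mono (r :: nat \<Rightarrow> nat)" "(z \<circ> r) \<longlonglongrightarrow> l"
      using bounded_imp_convergent_subsequence by blast
    have "l \<in> frechet_subdiff f x"
    proof (rule subgradient_limit)
      show "(w \<circ> r) \<longlonglongrightarrow> x" using w(2) lr(1) by (rule LIMSEQ_subseq_LIMSEQ)
      show "(z \<circ> r) \<longlonglongrightarrow> l" by fact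
      show "f ((w \<circ> r) n) = f x" for n using w x min_value by (auto simp: A_def)
      show "x \<in> interior (edom h)" using x Xs_subset X_subset by blast
    qed (use hint z in auto)
    then show "x \<in> A" using in_A x by blast
  qed
  then have "closedin (top_of_set X) A"
    using Xs_subset by (intro closed_subset) (auto simp: A_def)
  then have "A = X"
    using convex_connected[OF convex_X] op \<open>x0 \<in> A\<close> unfolding connected_clopen by blast
  then show False using ne Xs_subset by (auto simp: A_def)
qed

text \<open>This yields (1 - \<beta>)\<tau> \<le> 1. If \<open>x0\<close> is not a minimizer, it
  serves as the witness itself.\<close>

lemma subgradient_bound_ge:
  assumes b: "0 < \<beta>" "\<beta> \<le> 1" and x0: "x0 \<in> T \<beta>" "frechet_subdiff f x0 \<noteq> {}"
    and B: "\<And>z \<zeta>. z \<in> T 1 \<Longrightarrow> \<zeta> \<in> frechet_subdiff f z \<Longrightarrow> norm \<zeta> \<le> B"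
    and ne: "Xs \<noteq> X"
  shows "(1 - \<beta>) * \<mu> \<le> B"
proof -
  obtain z \<zeta> where z: "z \<in> T \<beta>" "z \<notin> Xs" "\<zeta> \<in> frechet_subdiff f z"
  proof (cases "x0 \<in> Xs")
    case True
    have "\<exists>z \<in> T \<beta> - Xs. z \<in> interior dom"
      by (rule exists_non_minimizer_in_tube[OF b(1) True x0(2) _ ne]) (rule B)
    then obtain z where z: "z \<in> T \<beta> - Xs" "z \<in> interior dom" by blast
    then have "frechet_subdiff f z \<noteq> {}"
      using X_subset by (intro exists_subgradient) (auto simp: tube_def)
    then show ?thesis using z that by blast
  qed (use x0 that in blast)
  then show ?thesis
    using norm_subgradient_ge[OF z(1,2) b z(3)] B[of z \<zeta>] tube_mono[OF b] by force
qed

end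

section \<open>Convergence of PSGA with constant step-size\<close>

theorem theorem4p4:
  fixes h f :: "real ^ 'n \<Rightarrow> ereal"
    and X Xs :: "(real ^ 'n) set"
    and fstar L :: ereal
    and \<rho> \<mu> \<nu> G \<beta> \<alpha> \<tau> D q :: real
    and x \<zeta> :: "nat \<Rightarrow> real ^ 'n"
  assumes h: "legendre h"
    and f: "proper_fun f" "\<rho> > 0" "rel_weakly_convex \<rho> h f"
    and X: "X \<subseteq> interior (edom h)" "X \<noteq> {}" "closed X" "convex X"
    and Xs: "Xs = argmin f X" "Xs \<noteq> {}"
    and fstar: "fstar = (INF z\<in>X. f z)" "fstar > -\<infinity>"
    and sharp: "\<mu> > 0" "\<forall>z\<in>X. ereal (\<mu> * infdist z Xs) \<le> f z - fstar"
    and growth: "0 < \<nu>" "\<nu> \<le> 1" "G > 0"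
      "\<forall>z\<in>X. infdist z Xs < (\<mu> / (\<rho> * G)) powr (1 / \<nu>) \<longrightarrow>
         (INF y\<in>proj Xs z. bregman h y z) \<le> ereal (G * infdist z Xs powr (1 + \<nu>))"
    and L: "L = subgrad_sup f (tube X Xs \<mu> \<rho> G \<nu> 1)"
    and \<tau>: "\<tau> = condition_ratio \<mu> L"
    and \<beta>: "0 < \<beta>" "\<beta> < 1"
    and x0: "x 0 \<in> tube X Xs \<mu> \<rho> G \<nu> \<beta>"
    and psga: "psga f X (\<lambda>_. \<alpha>) x \<zeta>"
    and \<alpha>: "0 < \<alpha>"
      "\<alpha> \<le> 2 * (1 - \<beta>) * \<tau> / sqrt (1 + 4 * (1 - \<beta>)\<^sup>2 * \<tau>\<^sup>2)
             * (\<beta> * \<mu> / (\<rho> * G)) powr (1 / \<nu>)"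
    and D: "D = \<alpha> / (2 * (1 - \<beta>) * \<tau>)"
    and q: "q = 1 - (1 - \<beta>) * \<alpha> * \<tau> * (\<rho> * G / (\<beta> * \<mu>)) powr (1 / \<nu>)"
  shows "(\<forall>k. (infdist (x k) Xs)\<^sup>2 - D\<^sup>2
               \<le> max (((infdist (x 0) Xs)\<^sup>2 - D\<^sup>2) * q ^ k) (\<alpha>\<^sup>2))
         \<and> (Xs \<noteq> X \<longrightarrow> q > 0)"
proof -
  have zeta: "\<zeta> k \<in> frechet_subdiff f (x k)" for k
    using psga by (simp add: psga_def)
  have upd: "if \<zeta> k = 0 then x (Suc k) = x k
      else x (Suc k) \<in> proj X (x k - (\<alpha> / norm (\<zeta> k)) *\<^sub>R \<zeta> k)" for k
    using psga by (simp add: psga_def)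
  have xX: "x k \<in> X" for k
  proof (induction k)
    case 0
    then show ?case using x0 by (simp add: tube_def)
  next
    case (Suc k)
    then show ?case using upd[of k]
      by (auto simp: proj_def argmin_def is_arg_min_def split: if_splits)
  qed
  have "fstar \<le> f (x 0)" unfolding fstar by (intro INF_lower xX)
  moreover have "\<bar>f (x 0)\<bar> \<noteq> \<infinity>" using zeta[of 0] by (simp add: frechet_subdiff_def)
  ultimately obtain m where m: "fstar = ereal m"
    using fstar(2) by (cases fstar) auto
  interpret relatively_weakly_convex h f \<rho>
    by unfold_locales (use h f in auto)
  interpret sharp_minimization h f \<rho> X Xs m \<mu> \<nu> G
  proof
    fix y assume "y \<in> Xs"
    then have y: "y \<in> X" "\<And>z. z \<in> X \<Longrightarrow> f y \<le> f z"
      by (auto simp: Xs argmin_def is_arg_min_def not_less)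
    have "(INF z\<in>X. f z) = f y"
      using y by (intro antisym INF_lower INF_greatest)
    then show "f y = ereal m" using m fstar by simp
  next
    fix z assume "z \<in> X"
    then have "ereal (\<mu> * infdist z Xs) \<le> f z - ereal m" using sharp m by auto
    then show "ereal (m + \<mu> * infdist z Xs) \<le> f z" by (cases "f z") auto
  qed (use X Xs sharp growth in \<open>auto simp: argmin_def is_arg_min_def\<close>)
  define R where "R = (\<beta> * \<mu> / (\<rho> * G)) powr (1 / \<nu>)"
  have R: "R > 0" using \<beta> mu_pos rho_pos G_pos by (simp add: R_def)
  have tau: "\<tau> > 0"
  proof (rule ccontr)
    assume "\<not> \<tau> > 0"
    then have "2 * (1 - \<beta>) * \<tau> / sqrt (1 + 4 * (1 - \<beta>)\<^sup>2 * \<tau>\<^sup>2) * R \<le> 0"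
      using \<beta> R by (intro mult_nonpos_nonneg divide_nonpos_nonneg mult_nonneg_nonpos) auto
    then show False using \<alpha> by (simp add: R_def)
  qed
  \<comment> \<open>For infinite or zero \<open>L\<close> the conversion to real gives \<tau> = 0,
    so \<tau> > 0 leaves only a finite \<open>L\<close>.\<close>
  then obtain B where B: "L = ereal B" "\<tau> = \<mu> / B"
    using mu_pos unfolding \<tau> condition_ratio_def by (cases L) (auto split: if_splits)
  have Bpos: "B > 0" using tau mu_pos by (simp add: B zero_less_divide_iff)
  have bd: "norm \<xi> \<le> B" if "z \<in> T 1" "\<xi> \<in> frechet_subdiff f z" for z \<xi>
  proof -
    have "ereal (norm \<xi>) \<le> L" unfolding L subgrad_sup_def using that by (intro SUP_upper) blast
    then show ?thesis by (simp add: B)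
  qed
  define c where "c = (1 - \<beta>) * \<tau>"
  have c: "c > 0" using \<beta> tau by (simp add: c_def)
  have Dc: "D = \<alpha> / (2 * c)" by (simp add: D c_def mult.assoc)
  have qc: "q = 1 - c * \<alpha> / R"
  proof -
    have "(\<rho> * G / (\<beta> * \<mu>)) powr (1 / \<nu>) = inverse R"
      using \<beta> mu_pos rho_pos G_pos unfolding R_def
      by (simp add: powr_divide inverse_eq_divide)
    then show ?thesis by (simp add: q c_def field_simps)
  qed
  have ac: "\<alpha> \<le> 2 * c / sqrt (1 + 4 * c\<^sup>2) * R"
    using \<alpha>(2) by (simp only: c_def R_def power_mult_distrib mult.assoc)
  have sq: "sqrt (1 + 4 * c\<^sup>2) > 0" by (simp add: add_pos_nonneg)
  have R_bound: "(\<alpha> / (2 * c))\<^sup>2 + \<alpha>\<^sup>2 \<le> R\<^sup>2"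
  proof -
    have "\<alpha> * sqrt (1 + 4 * c\<^sup>2) \<le> 2 * c * R" using ac sq by (simp add: field_simps)
    then have "(\<alpha> * sqrt (1 + 4 * c\<^sup>2))\<^sup>2 \<le> (2 * c * R)\<^sup>2"
      using \<alpha> sq by (intro power_mono) auto
    then have "\<alpha>\<^sup>2 * (1 + 4 * c\<^sup>2) \<le> 4 * c\<^sup>2 * R\<^sup>2" by (simp add: power_mult_distrib)
    then show ?thesis using c by (simp add: field_simps)
  qed
  \<comment> \<open>When \<open>Xs = X\<close>, sharpness holds for every \<mu>, and c may be so
    large that q is negative.\<close>
  have qpos: "q > 0" if "Xs \<noteq> X"
  proof -
    have "(1 - \<beta>) * \<mu> \<le> B"
      by (rule subgradient_bound_ge[OF \<beta>(1) _ x0 _ _ that]) (use \<beta> zeta[of 0] bd in auto)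
    then have c1: "c \<le> 1" using Bpos by (simp add: c_def B field_simps)
    \<comment> \<open>The step-size bound gives c\<alpha>/R \<le>
      \<open>2 * c\<^sup>2 / sqrt (1 + 4 * c\<^sup>2)\<close>, which is below 1 exactly under this
      inequality.\<close>
    have "(2 * c\<^sup>2)\<^sup>2 < 1 + 4 * c\<^sup>2"
    proof -
      have "c\<^sup>2 * c\<^sup>2 \<le> c\<^sup>2 * 1" using c c1 by (intro mult_left_mono) (auto simp: power_le_one)
      then show ?thesis by (simp add: power_mult_distrib power2_eq_square)
    qed
    then have "2 * c\<^sup>2 < sqrt (1 + 4 * c\<^sup>2)" by (rule real_less_rsqrt)
    then have "2 * c\<^sup>2 / sqrt (1 + 4 * c\<^sup>2) < 1" using sq by simp
    moreover have "c * \<alpha> / R \<le> 2 * c\<^sup>2 / sqrt (1 + 4 * c\<^sup>2)"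
    proof -
      have "c * \<alpha> / R \<le> c * (2 * c / sqrt (1 + 4 * c\<^sup>2) * R) / R"
        using ac c R by (intro divide_right_mono mult_left_mono) auto
      then show ?thesis using R by (simp add: power2_eq_square mult_ac)
    qed
    ultimately show ?thesis by (simp add: qc)
  qed
  have "(infdist (x k) Xs)\<^sup>2 - D\<^sup>2
      \<le> max (((infdist (x 0) Xs)\<^sup>2 - D\<^sup>2) * q ^ k) (\<alpha>\<^sup>2)" for k
  proof (cases "Xs = X")
    case True
    \<comment> \<open>The left side is then at most 0, so \<open>\<alpha>\<^sup>2\<close> bounds it
      whatever the sign of q.\<close>
    then have "infdist (x k) Xs = 0" using xX by simp
    then show ?thesis by (simp add: max_def) (smt (verit) zero_le_power2)
  next
    case False
    show ?thesis
      unfolding Dc qc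
    proof (rule constant_step_recursion)
      fix k assume "infdist (x k) Xs < R"
      then have xk: "x k \<in> T \<beta>" using xX by (simp add: tube_def R_def)
      show "(infdist (x (Suc k)) Xs)\<^sup>2
          \<le> (infdist (x k) Xs)\<^sup>2 - 2 * \<alpha> * c * infdist (x k) Xs + \<alpha>\<^sup>2"
      proof (cases "\<zeta> k = 0")
        case True
        \<comment> \<open>The iterate stays put at distance 0, and the recursion reads 0 \<le>
          \<open>\<alpha>\<^sup>2\<close>.\<close>
        then have "infdist (x k) Xs = 0"
          using infdist_eq_0_if_zero_subgradient[OF xk \<beta>] zeta[of k] by simp
        then show ?thesis using upd[of k] True by simp
      next
        case F: False
        have "norm (\<zeta> k) \<le> B" using bd[OF _ zeta[of k]] xk tube_mono \<beta> by force
        then show ?thesis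
          using psga_step[OF xk \<beta> zeta F _ \<alpha>(1)] upd[of k] F by (simp add: c_def B)
      qed
    qed (use x0 R_bound c \<alpha> qpos[OF False] in \<open>auto simp: infdist_nonneg tube_def R_def qc\<close>)
  qed
  then show ?thesis using qpos by blast
qed

end
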